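(* The tetrablock $$\mathbb{E}=\{x\in\mathbb{C}^3: |x_1-\bar x_2x_3|+|x_2-\bar x_1x_3|+|x_3|^2<1\}$$ is $\mathbb{C}$-convex.
   Context: A domain $D\subset\mathbb{C}^n$ is called $\mathbb{C}$-convex if for any affine complex line $l$ such that $l\cap D\neq\emptyset$ the set $l\cap D$ is connected and simply connected. *)

theory Defs
  imports "HOL-Analysis.Analysis"
begin

definition domain_set :: "(complex ^ 'n) set \<Rightarrow> bool" where
  "domain_set D \<longleftrightarrow> open D \<and> connected D \<and> D \<noteq> {}"

definition complex_line :: "(complex ^ 'n) set \<Rightarrow> bool" where
  "complex_line l \<longleftrightarrow> (\<exists>a v. v \<noteq> 0 \<and> l = range (\<lambda>t::complex. a + t *s v))"

text \<open>
  C-convexity is a property of domains, so being a domain is part of the definition.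
\<close>

definition C_convex :: "(complex ^ 'n) set \<Rightarrow> bool" where
  "C_convex D \<longleftrightarrow> domain_set D \<and>
     (\<forall>l. complex_line l \<and> l \<inter> D \<noteq> {} \<longrightarrow> connected (l \<inter> D) \<and> simply_connected (l \<inter> D))"

definition tetrablock :: "(complex ^ 3) set" where
  "tetrablock = {x. cmod (x $ 1 - cnj (x $ 2) * x $ 3) + cmod (x $ 2 - cnj (x $ 1) * x $ 3)
                      + (cmod (x $ 3))\<^sup>2 < 1}"

end

theory Submission
  imports Defs
begin

text \<open>
  Every complex line meets the tetrablock in a contractible set. On a line on which \<open>x\<^sub>3\<close> is constant
  the defining function is convex. On any other line \<open>x\<^sub>3\<close> serves as the parameter,
  \<open>x\<^sub>1 = a\<^sub>1 + b\<^sub>1 x\<^sub>3\<close> and \<open>x\<^sub>2 = a\<^sub>2 + b\<^sub>2 x\<^sub>3\<close>, and the two expressions inside the moduli become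
  affine functions of \<open>x\<^sub>3\<close> and \<open>|x\<^sub>3|\<^sup>2\<close>. Hence it is natural to lift
  \<open>x\<^sub>3 = y / (1 + h)\<close> by stereographic projection to the hyperboloid \<open>h\<^sup>2 - |y|\<^sup>2 = 1\<close>, \<open>h > 0\<close>:
  after multiplication by \<open>1 + h\<close> both expressions are affine in \<open>h\<close> and \<open>y\<close>, and \<open>1 - |x\<^sub>3|\<^sup>2\<close>
  turns into the constant \<open>2\<close>. With \<open>P = a\<^sub>1 - cnj b\<^sub>2\<close> and \<open>Q = a\<^sub>2 - cnj b\<^sub>1\<close> the defining inequality reads
  \<open>|\<mu> + P h - cnj Q y| + |\<nu> + Q h - cnj P y| < 2\<close> for suitable constants \<open>\<mu>\<close>, \<open>\<nu>\<close>
  (\<open>line_point_in_tetrablock_iff\<close>).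

  The special form of the coefficients matters because the two linear parts \<open>u = P h - cnj Q y\<close> and
  \<open>v = Q h - cnj P y\<close> satisfy \<open>|u|\<^sup>2 - |v|\<^sup>2 = (|P|\<^sup>2 - |Q|\<^sup>2) (h\<^sup>2 - |y|\<^sup>2)\<close>, also for differences. The
  difference of two points of the hyperboloid is spacelike, so if \<open>|Q| < |P|\<close> then \<open>u\<close> is a
  1-Lipschitz function of \<open>v\<close> (\<open>hyp_forms_dist_le\<close>). Moreover \<open>v\<close> is a global coordinate on the hyperboloid, a perturbation
  of a complex linear isomorphism by a contraction (\<open>hyp_coordinate_homeomorphism\<close>). In this coordinate the set is
  \<open>{v. |\<mu> + u(v)| + |\<nu> + v| < 2}\<close>, which is starlike about \<open>-\<nu>\<close>: moving towards \<open>-\<nu>\<close> decreases the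
  second term at unit speed, and the first cannot increase faster
  (\<open>contractible_sublevel_lipschitz\<close>). The case \<open>|P| < |Q|\<close> is symmetric,
  and if \<open>|P| = |Q| > 0\<close> then \<open>u\<close> and \<open>v\<close> are proportional to one coordinate that maps the hyperboloid onto
  a half-plane, where the set becomes convex
  (\<open>contractible_hyp_sublevel_null\<close>). If \<open>P = Q = 0\<close> the inequality does not depend on the
  point at all.

  Finally, the tetrablock is connected because each of its points lies with the origin on a line.
\<close>

section \<open>Contractible sets on the hyperboloid\<close>

text \<open>
  The sheet \<open>h\<^sup>2 - |y|\<^sup>2 = 1\<close>, \<open>h > 0\<close> of the hyperboloid is the graph of this function of \<open>y\<close>.
\<close>

definition hyp_height :: "complex \<Rightarrow> real" where
  "hyp_height y = sqrt (1 + (cmod y)\<^sup>2)"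

lemma hyp_height_sq: "(hyp_height y)\<^sup>2 = 1 + (cmod y)\<^sup>2"
  by (simp add: hyp_height_def)

lemma hyp_height_pos: "hyp_height y > 0"
  by (simp add: hyp_height_def add_pos_nonneg)

lemma cmod_less_hyp_height: "cmod y < hyp_height y"
  by (simp add: hyp_height_def real_less_rsqrt)

lemma continuous_on_hyp_height [continuous_intros]:
  "continuous_on S f \<Longrightarrow> continuous_on S (\<lambda>x. hyp_height (f x))"
  unfolding hyp_height_def by (intro continuous_intros)

text \<open>
  Differences of points of the hyperboloid are spacelike: \<open>h\<close> is the norm of the vector \<open>(1, y)\<close>,
  so this is the triangle inequality.
\<close>

lemma hyp_height_diff_le: "\<bar>hyp_height y - hyp_height z\<bar> \<le> cmod (y - z)"
proof -
  have "hyp_height w = norm (1::real, w)" for w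
    by (simp add: hyp_height_def norm_Pair)
  then have "\<bar>hyp_height y - hyp_height z\<bar> \<le> norm ((1::real, y) - (1, z))"
    by (metis norm_triangle_ineq3)
  then show ?thesis
    by (simp add: norm_Pair)
qed

text \<open>
  Both squares on the left have the same cross term \<open>2 r Re (P Q cnj z)\<close>, so only the Lorentz form
  is left.
\<close>

lemma cmod_sq_diff_lorentz:
  fixes P Q z :: complex and r :: real
  shows "(cmod (P * r - cnj Q * z))\<^sup>2 - (cmod (Q * r - cnj P * z))\<^sup>2
           = ((cmod P)\<^sup>2 - (cmod Q)\<^sup>2) * (r\<^sup>2 - (cmod z)\<^sup>2)"
  unfolding of_real_eq_iff [where 'a = complex, symmetric] of_real_diff of_real_mult of_real_power [of r]
    complex_norm_square complex_cnj_diff complex_cnj_mult complex_cnj_cnj complex_cnj_complex_of_real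
  by (simp add: power2_eq_square ring_distribs mult_ac)

text \<open>
  The left-hand side is a 1-Lipschitz function of the right-hand one along the hyperboloid: by the
  identity above, applied to a spacelike difference vector, the two squared moduli differ by
  \<open>|P|\<^sup>2 - |Q|\<^sup>2\<close> times a nonpositive number.
\<close>

lemma hyp_forms_dist_le:
  fixes P Q :: complex
  assumes "cmod Q \<le> cmod P"
  shows "cmod ((P * hyp_height y - cnj Q * y) - (P * hyp_height z - cnj Q * z))
         \<le> cmod ((Q * hyp_height y - cnj P * y) - (Q * hyp_height z - cnj P * z))"
    (is "cmod ?u \<le> cmod ?v")
proof -
  let ?r = "hyp_height y - hyp_height z"
  have u: "?u = P * ?r - cnj Q * (y - z)" and v: "?v = Q * ?r - cnj P * (y - z)"
    by (simp_all add: algebra_simps)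
  have "?r\<^sup>2 \<le> (cmod (y - z))\<^sup>2"
    using hyp_height_diff_le [of y z] by (metis abs_le_square_iff abs_norm_cancel)
  moreover have "(cmod Q)\<^sup>2 \<le> (cmod P)\<^sup>2"
    using assms by (simp add: power_mono)
  ultimately have "(cmod ?u)\<^sup>2 - (cmod ?v)\<^sup>2 \<le> 0"
    unfolding u v cmod_sq_diff_lorentz by (intro mult_nonneg_nonpos) auto
  then show ?thesis
    by (simp add: power2_le_iff_abs_le)
qed

text \<open>
  Up to the factor \<open>- cnj P\<close> the map is the identity perturbed by a contraction of constant \<open>|Q| / |P|\<close>;
  surjectivity is Banach's fixed point theorem, and the inverse is Lipschitz.
\<close>

lemma hyp_coordinate_homeomorphism:
  fixes P Q :: complex
  assumes "cmod Q < cmod P"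
  obtains g where "homeomorphism UNIV UNIV (\<lambda>y. Q * hyp_height y - cnj P * y) g"
proof -
  define v where "v = (\<lambda>y. Q * hyp_height y - cnj P * y)"
  have P0: "P \<noteq> 0"
    using assms by auto
  have lower: "(cmod P - cmod Q) * cmod (y - z) \<le> cmod (v y - v z)" for y z
  proof -
    have "v y - v z = Q * of_real (hyp_height y - hyp_height z) - cnj P * (y - z)"
      by (simp add: v_def algebra_simps)
    then have "cmod (v y - v z) \<ge> cmod P * cmod (y - z) - cmod Q * \<bar>hyp_height y - hyp_height z\<bar>"
      by (metis norm_minus_commute norm_triangle_ineq2 norm_mult complex_mod_cnj norm_of_real)
    moreover have "cmod Q * \<bar>hyp_height y - hyp_height z\<bar> \<le> cmod Q * cmod (y - z)"
      by (intro mult_left_mono hyp_height_diff_le) auto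
    ultimately show ?thesis
      by (simp add: algebra_simps)
  qed
  have "\<exists>y. v y = w" for w
  proof -
    \<comment> \<open>the fixed points of \<open>T\<close> are the solutions of \<open>v y = w\<close>\<close>
    define T where "T = (\<lambda>y. (Q * hyp_height y - w) / cnj P)"
    have "dist (T y) (T z) \<le> (cmod Q / cmod P) * dist y z" for y z
    proof -
      have "T y - T z = Q * of_real (hyp_height y - hyp_height z) / cnj P"
        by (simp add: T_def diff_divide_distrib algebra_simps)
      then have "dist (T y) (T z) = (cmod Q / cmod P) * \<bar>hyp_height y - hyp_height z\<bar>"
        unfolding dist_norm by (metis norm_divide norm_mult complex_mod_cnj norm_of_real
            times_divide_eq_left)
      also have "\<dots> \<le> (cmod Q / cmod P) * dist y z"
        unfolding dist_norm by (intro mult_left_mono hyp_height_diff_le) auto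
      finally show ?thesis .
    qed
    then have "\<exists>!y\<in>UNIV. T y = y"
      using assms P0 by (intro Banach_fix [where c = "cmod Q / cmod P"]) (auto simp: complete_UNIV)
    then obtain y where "T y = y"
      by blast
    then have "v y = w"
      using P0 by (simp add: T_def v_def field_simps)
    then show ?thesis ..
  qed
  then obtain g where vg: "v (g w) = w" for w
    by metis
  have gv: "g (v y) = y" for y
  proof -
    have "(cmod P - cmod Q) * cmod (g (v y) - y) \<le> 0"
      using lower [of "g (v y)" y] by (simp add: vg)
    then show ?thesis
      using assms by (simp add: mult_le_0_iff)
  qed
  have contg: "continuous_on UNIV g"
  proof (rule continuous_on_subset [OF lipschitz_on_continuous_on])
    show "(1 / (cmod P - cmod Q))-lipschitz_on UNIV g"
    proof (rule lipschitz_onI)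
      fix w w'
      have "(cmod P - cmod Q) * cmod (g w - g w') \<le> cmod (w - w')"
        using lower [of "g w" "g w'"] by (simp add: vg)
      then show "dist (g w) (g w') \<le> 1 / (cmod P - cmod Q) * dist w w'"
        using assms by (simp add: dist_norm field_simps)
    qed (use assms in auto)
  qed auto
  have "continuous_on UNIV v"
    unfolding v_def by (intro continuous_intros)
  with contg have "homeomorphism UNIV UNIV v g"
    by (intro homeomorphismI) (auto simp: vg gv)
  then show ?thesis
    using that v_def by blast
qed

text \<open>
  Moving \<open>w\<close> a distance \<open>d\<close> towards \<open>-\<nu>\<close> lowers the second modulus by \<open>d\<close> and, by the Lipschitz
  condition, raises the first by at most \<open>d\<close>.
\<close>

lemma contractible_sublevel_lipschitz:
  fixes f :: "'a::real_normed_vector \<Rightarrow> 'b::real_normed_vector"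
  assumes lip: "\<And>w w'. norm (f w - f w') \<le> norm (w - w')"
  shows "contractible {w. norm (f w) + norm (\<nu> + w) < c}" (is "contractible ?T")
proof (cases "?T = {}")
  case False
  have shrink: "w' \<in> ?T" if w: "w \<in> ?T" and w': "w' \<in> closed_segment (- \<nu>) w" for w w'
  proof -
    obtain s where s: "0 \<le> s" "s \<le> 1" and w'_eq: "w' = (1 - s) *\<^sub>R (- \<nu>) + s *\<^sub>R w"
      using w' by (auto simp: in_segment)
    have "\<nu> + w' = s *\<^sub>R (\<nu> + w)" and "w' - w = - ((1 - s) *\<^sub>R (\<nu> + w))"
      by (simp_all add: w'_eq algebra_simps)
    then have *: "norm (\<nu> + w') = s * norm (\<nu> + w)" "norm (w' - w) = (1 - s) * norm (\<nu> + w)"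
      using s by simp_all
    have "norm (f w') \<le> norm (f w) + norm (f w' - f w)"
      by (rule norm_triangle_sub)
    also have "\<dots> \<le> norm (f w) + (1 - s) * norm (\<nu> + w)"
      using lip [of w' w] * by simp
    finally show ?thesis
      using w * by (simp add: algebra_simps)
  qed
  obtain w where "w \<in> ?T"
    using False by blast
  then have "- \<nu> \<in> ?T"
    using shrink by blast
  then have "starlike ?T"
    unfolding starlike_def using shrink by blast
  then show ?thesis
    by (rule starlike_imp_contractible)
qed (metis contractible_empty)

lemma contractible_homeomorphism_preimage:
  fixes f :: "'a::real_normed_vector \<Rightarrow> 'b::real_normed_vector"
  assumes "homeomorphism X Y f g" "S \<subseteq> X" "f ` S = T" "T \<subseteq> Y" "contractible T"
  shows "contractible S"
proof -
  have "homeomorphism S T f g"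
    using assms by (metis homeomorphism_of_subsets)
  then have "S homeomorphic T"
    unfolding homeomorphic_def by blast
  then show ?thesis
    using \<open>contractible T\<close> by (simp add: homeomorphic_contractible_eq)
qed

lemma contractible_hyp_sublevel_strict:
  fixes P Q \<mu> \<nu> :: complex
  assumes "cmod Q < cmod P"
  shows "contractible {y. cmod (\<mu> + (P * hyp_height y - cnj Q * y))
                          + cmod (\<nu> + (Q * hyp_height y - cnj P * y)) < c}" (is "contractible ?S")
proof -
  define u where "u = (\<lambda>y. P * hyp_height y - cnj Q * y)"
  define v where "v = (\<lambda>y. Q * hyp_height y - cnj P * y)"
  obtain g where hom: "homeomorphism UNIV UNIV v g"
    by (rule hyp_coordinate_homeomorphism [OF assms, folded v_def])
  let ?T = "{w. cmod (\<mu> + u (g w)) + cmod (\<nu> + w) < c}"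
  have gv: "g (v y) = y" and vg: "v (g w) = w" for y w
    using homeomorphism_apply1 [OF hom] homeomorphism_apply2 [OF hom] by simp_all
  have "cmod (u y - u z) \<le> cmod (v y - v z)" for y z
    unfolding u_def v_def using assms by (intro hyp_forms_dist_le) simp
  from this [of "g w" "g w'" for w w']
  have contr: "contractible ?T"
    by (intro contractible_sublevel_lipschitz [of "\<lambda>w. \<mu> + u (g w)"]) (simp add: vg)
  have S: "?S = {y. cmod (\<mu> + u y) + cmod (\<nu> + v y) < c}"
    by (simp only: u_def v_def)
  have img: "v ` ?S = ?T"
  proof
    show "v ` ?S \<subseteq> ?T"
      unfolding S by (auto simp only: gv mem_Collect_eq)
    show "?T \<subseteq> v ` ?S"
    proof
      fix w assume "w \<in> ?T"
      then have "g w \<in> ?S"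
        unfolding S by (simp only: vg mem_Collect_eq)
      then have "v (g w) \<in> v ` ?S"
        by (rule imageI)
      then show "w \<in> v ` ?S"
        by (simp only: vg)
    qed
  qed
  show ?thesis
    by (rule contractible_homeomorphism_preimage [OF hom subset_UNIV img subset_UNIV contr])
qed

text \<open>
  For \<open>|e| = 1\<close> the kernel of \<open>h - e y\<close> is a null direction, so the coordinate only covers a
  half-plane. The inverse comes from \<open>h = w + e y\<close> being real and \<open>h\<^sup>2 = 1 + |h - w|\<^sup>2\<close>, which
  determines \<open>h = (1 + |w|\<^sup>2) / (2 Re w)\<close>.
\<close>

lemma hyp_null_coordinate_homeomorphism:
  assumes e: "cmod e = 1"
  shows "homeomorphism UNIV {w. Re w > 0} (\<lambda>y. hyp_height y - e * y)
           (\<lambda>w. cnj e * (((1 + (cmod w)\<^sup>2) / (2 * Re w)) - w))"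
    (is "homeomorphism UNIV ?H ?q ?g")
proof -
  have ee: "e * cnj e = 1" "cnj e * e = 1"
    using e by (simp_all add: complex_norm_square [symmetric] mult.commute)
  have q_pos: "Re (?q y) > 0" for y
    using complex_Re_le_cmod [of "e * y"] cmod_less_hyp_height [of y] e by (simp add: norm_mult)
  have gq: "?g (?q y) = y" for y
  proof -
    have "(cmod (?q y))\<^sup>2 = (hyp_height y)\<^sup>2 - 2 * hyp_height y * Re (e * y) + (cmod (e * y))\<^sup>2"
      unfolding cmod_power2 by (simp add: power2_eq_square algebra_simps)
    also have "(cmod (e * y))\<^sup>2 = (hyp_height y)\<^sup>2 - 1"
      using e by (simp add: norm_mult hyp_height_sq)
    finally have "1 + (cmod (?q y))\<^sup>2 = hyp_height y * (2 * Re (?q y))"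
      by (simp add: power2_eq_square algebra_simps)
    then have "(1 + (cmod (?q y))\<^sup>2) / (2 * Re (?q y)) = hyp_height y"
      using q_pos [of y] by (simp add: divide_eq_eq)
    then have "?g (?q y) = cnj e * e * y"
      by (simp only:) (simp add: algebra_simps)
    then show ?thesis
      by (simp add: ee)
  qed
  have qg: "?q (?g w) = w" if w: "Re w > 0" for w
  proof -
    define r where "r = (1 + (cmod w)\<^sup>2) / (2 * Re w)"
    define y where "y = cnj e * (of_real r - w)"
    have r0: "r > 0"
      using w by (auto simp: r_def intro!: divide_pos_pos add_pos_nonneg)
    have "r * (2 * Re w) = 1 + (cmod w)\<^sup>2"
      using w by (simp add: r_def)
    moreover have "(cmod y)\<^sup>2 = (cmod (of_real r - w))\<^sup>2"
      using e by (simp add: y_def norm_mult)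
    ultimately have "1 + (cmod y)\<^sup>2 = r\<^sup>2"
      unfolding cmod_power2 by (simp add: power2_eq_square algebra_simps)
    then have h: "hyp_height y = r"
      using r0 by (simp add: hyp_height_def)
    have "e * y = of_real r - w"
      by (simp add: y_def ee mult.assoc [symmetric])
    then have "?q y = w"
      by (simp add: h)
    then show ?thesis
      by (simp only: y_def r_def)
  qed
  have "continuous_on UNIV ?q"
    by (intro continuous_intros)
  moreover have "continuous_on ?H ?g"
    by (intro continuous_intros) auto
  ultimately show ?thesis
    by (rule homeomorphismI) (use q_pos gq qg in auto)
qed

lemma convex_sublevel_sum_norm:
  fixes f :: "'a::real_vector \<Rightarrow> 'b::real_normed_vector"
    and g :: "'a::real_vector \<Rightarrow> 'c::real_normed_vector"
  assumes "convex S"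
    and f: "\<And>x y t. x \<in> S \<Longrightarrow> y \<in> S \<Longrightarrow> f ((1 - t) *\<^sub>R x + t *\<^sub>R y) = (1 - t) *\<^sub>R f x + t *\<^sub>R f y"
    and g: "\<And>x y t. x \<in> S \<Longrightarrow> y \<in> S \<Longrightarrow> g ((1 - t) *\<^sub>R x + t *\<^sub>R y) = (1 - t) *\<^sub>R g x + t *\<^sub>R g y"
  shows "convex {x \<in> S. norm (f x) + norm (g x) < c}"
proof (rule convexI)
  fix x y and u v :: real
  assume x: "x \<in> {x \<in> S. norm (f x) + norm (g x) < c}"
    and y: "y \<in> {x \<in> S. norm (f x) + norm (g x) < c}"
    and uv: "0 \<le> u" "0 \<le> v" "u + v = 1"
  let ?z = "u *\<^sub>R x + v *\<^sub>R y"
  have u: "u = 1 - v"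
    using uv by simp
  have "f ?z = u *\<^sub>R f x + v *\<^sub>R f y" "g ?z = u *\<^sub>R g x + v *\<^sub>R g y"
    using x y by (simp_all add: u f g)
  then have "norm (f ?z) \<le> u * norm (f x) + v * norm (f y)"
    "norm (g ?z) \<le> u * norm (g x) + v * norm (g y)"
    using uv norm_triangle_ineq [of "u *\<^sub>R f x" "v *\<^sub>R f y"]
      norm_triangle_ineq [of "u *\<^sub>R g x" "v *\<^sub>R g y"] by simp_all
  then have "norm (f ?z) + norm (g ?z)
      \<le> u * (norm (f x) + norm (g x)) + v * (norm (f y) + norm (g y))"
    by (simp add: algebra_simps)
  also have "\<dots> < c"
    using x y uv by (intro convex_bound_lt) auto
  finally show "?z \<in> {x \<in> S. norm (f x) + norm (g x) < c}"
    using x y uv \<open>convex S\<close> by (simp add: convexD)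
qed

text \<open>
  For \<open>e = cnj P / Q\<close> the two linear forms are \<open>P w\<close> and \<open>Q w\<close> in the null coordinate
  \<open>w = h - e y\<close>; the sublevel set is convex in \<open>w\<close>.
\<close>

lemma contractible_hyp_sublevel_null:
  fixes P Q \<mu> \<nu> :: complex
  assumes eq: "cmod P = cmod Q" and Q0: "Q \<noteq> 0"
  shows "contractible {y. cmod (\<mu> + (P * hyp_height y - cnj Q * y))
                          + cmod (\<nu> + (Q * hyp_height y - cnj P * y)) < c}" (is "contractible ?S")
proof -
  define e where "e = cnj P / Q"
  have e1: "cmod e = 1"
    using eq Q0 by (simp add: e_def norm_divide)
  have Qe: "Q * e = cnj P"
    using Q0 by (simp add: e_def)
  have "P * cnj P = Q * cnj Q"
    using eq by (simp add: complex_norm_square [symmetric])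
  then have Pe: "P * e = cnj Q"
    using Q0 by (simp add: e_def)
  let ?T = "{w. Re w > 0 \<and> cmod (\<mu> + P * w) + cmod (\<nu> + Q * w) < c}"
  let ?q = "\<lambda>y. hyp_height y - e * y"
  have forms: "P * hyp_height y - cnj Q * y = P * ?q y" "Q * hyp_height y - cnj P * y = Q * ?q y" for y
    by (simp_all add: Pe [symmetric] Qe [symmetric] algebra_simps)
  note hom = hyp_null_coordinate_homeomorphism [OF e1]
  have img: "?q ` ?S = ?T"
  proof
    show "?q ` ?S \<subseteq> ?T"
      using homeomorphism_image1 [OF hom] unfolding forms by blast
    show "?T \<subseteq> ?q ` ?S"
    proof
      fix w assume w: "w \<in> ?T"
      then obtain y where "w = ?q y"
        using homeomorphism_image1 [OF hom] by blast
      with w show "w \<in> ?q ` ?S"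
        unfolding forms by blast
    qed
  qed
  have "convex {w \<in> {w. Re w > 0}. cmod (\<mu> + P * w) + cmod (\<nu> + Q * w) < c}"
    by (rule convex_sublevel_sum_norm)
      (auto simp: convex_halfspace_Re_gt scaleR_conv_of_real algebra_simps)
  then have contr: "contractible ?T"
    by (intro convex_imp_contractible) simp
  show ?thesis
    by (rule contractible_homeomorphism_preimage [OF hom subset_UNIV img _ contr]) blast
qed

lemma contractible_hyp_sublevel:
  fixes P Q \<mu> \<nu> :: complex
  shows "contractible {y. cmod (\<mu> + (P * hyp_height y - cnj Q * y))
                    + cmod (\<nu> + (Q * hyp_height y - cnj P * y)) < c}" (is "contractible ?S")
proof -
  consider "cmod Q < cmod P" | "cmod P < cmod Q" | "cmod P = cmod Q" "Q \<noteq> 0" | "P = 0" "Q = 0"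
    by fastforce
  then show ?thesis
  proof cases
    case 1
    then show ?thesis
      by (rule contractible_hyp_sublevel_strict)
  next
    case 2
    then show ?thesis
      using contractible_hyp_sublevel_strict [of P Q \<nu> \<mu> c] by (simp add: add.commute)
  next
    case 3
    then show ?thesis
      by (rule contractible_hyp_sublevel_null)
  next
    case 4
    then have "?S = UNIV \<or> ?S = {}"
      by auto
    then show ?thesis
      by (elim disjE) (simp_all only: contractible_UNIV contractible_empty)
  qed
qed

section \<open>Complex lines in the tetrablock\<close>

lemma tetrablock_cmod_3_less:
  assumes "x \<in> tetrablock"
  shows "cmod (x $ 3) < 1"
proof -
  have "0 \<le> cmod (x $ 1 - cnj (x $ 2) * x $ 3)" "0 \<le> cmod (x $ 2 - cnj (x $ 1) * x $ 3)"
    by simp_all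
  then have "(cmod (x $ 3))\<^sup>2 < 1"
    using assms unfolding tetrablock_def mem_Collect_eq by linarith
  then show ?thesis
    by (simp add: abs_square_less_1)
qed

text \<open>
  Stereographic projection of the hyperboloid point over \<open>y\<close> from \<open>(-1, 0)\<close> to the unit disc.
\<close>

definition stereo :: "complex \<Rightarrow> complex" where
  "stereo y = y / (1 + hyp_height y)"

lemma one_plus_hyp_height_nz: "1 + complex_of_real (hyp_height y) \<noteq> 0"
proof -
  have "1 + hyp_height y \<noteq> 0"
    using hyp_height_pos [of y] by simp
  then show ?thesis
    by (metis of_real_1 of_real_add of_real_eq_0_iff)
qed

lemma cmod_stereo: "cmod (stereo y) = cmod y / (1 + hyp_height y)"
proof -
  have "cmod (complex_of_real (1 + hyp_height y)) = 1 + hyp_height y"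
    using hyp_height_pos [of y] by (simp only: norm_of_real)
  then show ?thesis
    by (simp add: stereo_def norm_divide)
qed

lemma one_minus_cmod_stereo_sq: "1 - (cmod (stereo y))\<^sup>2 = 2 / (1 + hyp_height y)"
proof -
  have pos: "1 + hyp_height y > 0"
    using hyp_height_pos [of y] by simp
  have "1 - (cmod (stereo y))\<^sup>2 = ((1 + hyp_height y)\<^sup>2 - (cmod y)\<^sup>2) / (1 + hyp_height y)\<^sup>2"
    using pos by (simp add: cmod_stereo power_divide diff_divide_distrib)
  also have "(1 + hyp_height y)\<^sup>2 - (cmod y)\<^sup>2 = 2 * (1 + hyp_height y)"
    using hyp_height_sq [of y] by (simp add: power2_sum)
  also have "2 * (1 + hyp_height y) / (1 + hyp_height y)\<^sup>2 = 2 / (1 + hyp_height y)"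
    using pos unfolding power2_eq_square by (metis less_irrefl mult_divide_mult_cancel_right)
  finally show ?thesis .
qed

lemma stereo_homeomorphism:
  "homeomorphism UNIV (ball 0 1) stereo (\<lambda>t. 2 * t / (1 - (cmod t)\<^sup>2))"
proof (rule homeomorphismI)
  show "continuous_on UNIV stereo"
    unfolding stereo_def using one_plus_hyp_height_nz by (intro continuous_intros) auto
  have "1 - (complex_of_real (cmod t))\<^sup>2 \<noteq> 0" if "t \<in> ball 0 1" for t :: complex
  proof -
    have "(cmod t)\<^sup>2 \<noteq> 1"
      using that abs_square_less_1 [of "cmod t"] by simp
    then show ?thesis
      by (metis eq_iff_diff_eq_0 of_real_eq_1_iff of_real_power)
  qed
  then show "continuous_on (ball 0 1) (\<lambda>t. 2 * t / (1 - (cmod t)\<^sup>2))"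
    by (intro continuous_intros) auto
  show "stereo ` UNIV \<subseteq> ball 0 1"
  proof clarify
    fix y
    show "stereo y \<in> ball 0 1"
      using cmod_less_hyp_height [of y] hyp_height_pos [of y] by (simp add: cmod_stereo)
  qed
next
  fix y :: complex
  show "2 * stereo y / complex_of_real (1 - (cmod (stereo y))\<^sup>2) = y"
    unfolding one_minus_cmod_stereo_sq using one_plus_hyp_height_nz [of y] by (simp add: stereo_def)
next
  fix t :: complex
  assume t: "t \<in> ball 0 1"
  define s where "s = (cmod t)\<^sup>2"
  define y where "y = 2 * t / complex_of_real (1 - s)"
  have s: "0 \<le> s" "s < 1"
    using t by (simp_all add: s_def abs_square_less_1)
  have "cmod y = 2 * cmod t / (1 - s)"
    using s unfolding y_def norm_divide norm_mult norm_of_real by simp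
  then have "1 + (cmod y)\<^sup>2 = ((1 - s)\<^sup>2 + 4 * s) / (1 - s)\<^sup>2"
    using s by (simp add: power_divide power_mult_distrib s_def add_divide_distrib)
  also have "(1 - s)\<^sup>2 + 4 * s = (1 + s)\<^sup>2"
    by (simp add: power2_eq_square algebra_simps)
  finally have "hyp_height y = (1 + s) / (1 - s)"
    using s by (simp add: hyp_height_def real_sqrt_divide)
  then have "1 + hyp_height y = 2 / (1 - s)"
    using s by (simp add: field_simps)
  then have "1 + complex_of_real (hyp_height y) = 2 / complex_of_real (1 - s)"
    by (metis of_real_1 of_real_add of_real_divide of_real_numeral)
  moreover have "complex_of_real (1 - s) \<noteq> 0"
    using s by (simp only: of_real_eq_0_iff)
  ultimately show "stereo (2 * t / complex_of_real (1 - (cmod t)\<^sup>2)) = t"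
    unfolding s_def [symmetric] y_def [symmetric]
    by (simp only: stereo_def) (simp only: y_def, simp)
qed auto

text \<open>
  With \<open>h = hyp_height y\<close>, a single factor \<open>1 + h\<close> clears the denominators of both \<open>t\<close> and \<open>|t|\<^sup>2\<close>,
  because \<open>|t|\<^sup>2 = (h - 1) / (h + 1)\<close>.
\<close>

lemma stereo_form:
  fixes p q r s y :: complex
  defines "t \<equiv> stereo y"
  shows "((p + r * t) - cnj (q + s * t) * t) * (1 + hyp_height y)
          = (p + cnj s) + ((p - cnj s) * hyp_height y - cnj (q - cnj r) * y)"
proof -
  define h where "h = complex_of_real (hyp_height y)"
  have nz: "1 + h \<noteq> 0"
    using one_plus_hyp_height_nz [of y] by (simp add: h_def)
  have ch: "cnj h = h"
    by (simp add: h_def)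
  have "complex_of_real ((hyp_height y)\<^sup>2) = of_real 1 + of_real ((cmod y)\<^sup>2)"
    by (simp only: hyp_height_sq of_real_add)
  then have "h * h = 1 + y * cnj y"
    unfolding complex_norm_square by (simp add: h_def power2_eq_square)
  then have yy: "y * cnj y = h * h - 1"
    by simp
  have t: "t * (1 + h) = y"
    using nz by (simp add: t_def stereo_def h_def)
  have "(t * cnj t * (1 + h)) * (1 + h) = (t * (1 + h)) * cnj (t * (1 + h))"
    by (simp only: complex_cnj_mult complex_cnj_add complex_cnj_one ch mult_ac)
  also have "\<dots> = (h - 1) * (1 + h)"
    unfolding t yy by (simp add: algebra_simps)
  finally have tt: "t * cnj t * (1 + h) = h - 1"
    using nz by simp
  have "((p + r * t) - cnj (q + s * t) * t) * (1 + h)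
        = p * (1 + h) + (r - cnj q) * (t * (1 + h)) - cnj s * (t * cnj t * (1 + h))"
    by (simp add: algebra_simps)
  also have "\<dots> = (p + cnj s) + ((p - cnj s) * h - cnj (q - cnj r) * y)"
    unfolding t tt by (simp add: algebra_simps)
  finally show ?thesis
    by (simp add: h_def)
qed

lemma line_point_in_tetrablock_iff:
  fixes a b :: "complex ^ 3"
  assumes "a $ 3 = 0" "b $ 3 = 1"
  shows "a + stereo y *s b \<in> tetrablock \<longleftrightarrow>
         cmod ((a $ 1 + cnj (b $ 2))
               + ((a $ 1 - cnj (b $ 2)) * hyp_height y - cnj (a $ 2 - cnj (b $ 1)) * y))
         + cmod ((a $ 2 + cnj (b $ 1))
               + ((a $ 2 - cnj (b $ 1)) * hyp_height y - cnj (a $ 1 - cnj (b $ 2)) * y)) < 2"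
    (is "_ \<longleftrightarrow> cmod ?F + cmod ?G < 2")
proof -
  let ?x = "a + stereo y *s b" and ?k = "1 + hyp_height y"
  have k: "?k > 0"
    using hyp_height_pos [of y] by simp
  have F: "(?x $ 1 - cnj (?x $ 2) * ?x $ 3) * ?k = ?F"
    using stereo_form [of "a $ 1" "b $ 1" y "a $ 2" "b $ 2"] assms by (simp add: mult.commute)
  have G: "(?x $ 2 - cnj (?x $ 1) * ?x $ 3) * ?k = ?G"
    using stereo_form [of "a $ 2" "b $ 2" y "a $ 1" "b $ 1"] assms by (simp add: mult.commute)
  have "?x $ 3 = stereo y"
    using assms by simp
  then have "(1 - (cmod (?x $ 3))\<^sup>2) * ?k = 2 / ?k * ?k"
    by (simp only: one_minus_cmod_stereo_sq)
  also have "\<dots> = 2"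
    using k by (metis less_irrefl nonzero_eq_divide_eq)
  finally have "(1 - (cmod (?x $ 3))\<^sup>2) * ?k = 2" .
  moreover have cmod_k: "cmod (z * of_real ?k) = cmod z * ?k" for z
    using k by (simp only: norm_mult norm_of_real abs_of_pos)
  moreover note arg_cong [OF F, of cmod, unfolded cmod_k] arg_cong [OF G, of cmod, unfolded cmod_k]
  ultimately have "cmod ?F + cmod ?G < 2 \<longleftrightarrow>
      (cmod (?x $ 1 - cnj (?x $ 2) * ?x $ 3) + cmod (?x $ 2 - cnj (?x $ 1) * ?x $ 3)) * ?k
        < (1 - (cmod (?x $ 3))\<^sup>2) * ?k"
    by (simp only: distrib_right)
  also have "\<dots> \<longleftrightarrow> ?x \<in> tetrablock"
    using k unfolding tetrablock_def mem_Collect_eq mult_less_cancel_right_pos [OF k] by linarith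
  finally show ?thesis ..
qed

text \<open>
  Such a line is parametrised by its third coordinate, which runs through the unit disc only, so
  inverse stereographic projection carries the slice to a sublevel set on the hyperboloid.
\<close>

lemma contractible_tetrablock_line_transversal:
  fixes a b :: "complex ^ 3"
  assumes "a $ 3 = 0" "b $ 3 = 1"
  shows "contractible (range (\<lambda>t. a + t *s b) \<inter> tetrablock)"
proof -
  let ?S = "{y. a + stereo y *s b \<in> tetrablock}"
  let ?f = "\<lambda>y. a + stereo y *s b"
  obtain g where hom: "homeomorphism UNIV (ball 0 1) stereo g"
    using stereo_homeomorphism by blast
  have "contractible ?S"
    unfolding line_point_in_tetrablock_iff [OF assms] by (rule contractible_hyp_sublevel)
  moreover have "homeomorphism ?S (range (\<lambda>t. a + t *s b) \<inter> tetrablock) ?f (\<lambda>x. g (x $ 3))"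
  proof (rule homeomorphismI)
    have "continuous_on ?S stereo"
      using hom by (meson continuous_on_subset homeomorphism_cont1 subset_UNIV)
    then show "continuous_on ?S ?f"
      unfolding vector_scalar_mult_def by (intro continuous_intros)
    have "(\<lambda>x. x $ 3) ` tetrablock \<subseteq> ball 0 1"
      using tetrablock_cmod_3_less by auto
    then show "continuous_on (range (\<lambda>t. a + t *s b) \<inter> tetrablock) (\<lambda>x. g (x $ 3))"
      by (intro continuous_on_compose2 [OF homeomorphism_cont2 [OF hom]] continuous_intros) auto
    show "g (?f y $ 3) = y" for y
      using assms homeomorphism_apply1 [OF hom] by simp
    show line_inv: "?f (g (x $ 3)) = x" if x_in: "x \<in> range (\<lambda>t. a + t *s b) \<inter> tetrablock" for x
    proof -
      obtain t where x: "x = a + t *s b"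
        using x_in by blast
      then have "x $ 3 = t"
        using assms by simp
      moreover have "x $ 3 \<in> ball 0 1"
        using x_in tetrablock_cmod_3_less by simp
      ultimately show ?thesis
        using x homeomorphism_apply2 [OF hom] by simp
    qed
    show "(\<lambda>x. g (x $ 3)) ` (range (\<lambda>t. a + t *s b) \<inter> tetrablock) \<subseteq> ?S"
    proof (rule image_subsetI)
      fix x assume x_in: "x \<in> range (\<lambda>t. a + t *s b) \<inter> tetrablock"
      then have "x \<in> tetrablock"
        by blast
      then show "g (x $ 3) \<in> ?S"
        by (simp only: line_inv [OF x_in] mem_Collect_eq)
    qed
  qed auto
  ultimately show ?thesis
    using homeomorphic_contractible_eq homeomorphic_def by blast
qed

text \<open>
  Once \<open>x\<^sub>3\<close> is constant, both expressions inside the moduli are real affine in \<open>x\<^sub>1\<close> and \<open>x\<^sub>2\<close>.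
\<close>

lemma contractible_tetrablock_line_horizontal:
  fixes a b :: "complex ^ 3"
  assumes "b $ 3 = 0"
  shows "contractible (range (\<lambda>t. a + t *s b) \<inter> tetrablock)"
proof -
  let ?l = "range (\<lambda>t. a + t *s b)"
  have "convex ?l"
  proof (rule convexI)
    fix x y and u v :: real
    assume "x \<in> ?l" "y \<in> ?l" and uv: "u + v = 1"
    then obtain s t where x: "x = a + s *s b" and y: "y = a + t *s b"
      by blast
    have eq: "u *\<^sub>R x + v *\<^sub>R y = (u + v) *\<^sub>R a + (of_real u * s + of_real v * t) *s b"
      unfolding x y by (simp add: vec_eq_iff scaleR_conv_of_real [where 'a = complex] algebra_simps)
    show "u *\<^sub>R x + v *\<^sub>R y \<in> ?l"
      unfolding eq uv scaleR_one by (rule rangeI)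
  qed
  then have "convex {x \<in> ?l. cmod (x $ 1 - cnj (x $ 2) * a $ 3) + cmod (x $ 2 - cnj (x $ 1) * a $ 3)
                        < 1 - (cmod (a $ 3))\<^sup>2}"
    by (rule convex_sublevel_sum_norm)
      (simp_all add: scaleR_conv_of_real [where 'a = complex] algebra_simps)
  moreover have "x $ 3 = a $ 3" if "x \<in> ?l" for x
    using that assms by auto
  then have "?l \<inter> tetrablock
      = {x \<in> ?l. cmod (x $ 1 - cnj (x $ 2) * a $ 3) + cmod (x $ 2 - cnj (x $ 1) * a $ 3)
                        < 1 - (cmod (a $ 3))\<^sup>2}"
    unfolding tetrablock_def by (auto simp: less_diff_eq assms)
  ultimately show ?thesis
    using convex_imp_contractible by metis
qed

lemma contractible_tetrablock_line:
  assumes "complex_line l"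
  shows "contractible (l \<inter> tetrablock)"
proof -
  obtain a b where l: "l = range (\<lambda>t. a + t *s b)"
    using assms unfolding complex_line_def by blast
  show ?thesis
  proof (cases "b $ 3 = 0")
    case True
    then show ?thesis
      unfolding l by (rule contractible_tetrablock_line_horizontal)
  next
    case False
    define b' where "b' = (1 / b $ 3) *s b"
    \<comment> \<open>shift and rescale the parameter of the line so that it equals the third coordinate\<close>
    define a' where "a' = a - (a $ 3) *s b'"
    have "a + t *s b = a' + (a $ 3 + t * b $ 3) *s b'" for t
      using False by (simp add: a'_def b'_def vec_eq_iff algebra_simps)
    moreover have "a' + t *s b' = a + ((t - a $ 3) / b $ 3) *s b" for t
      using False by (simp add: a'_def b'_def vec_eq_iff field_simps)
    ultimately have "l = range (\<lambda>t. a' + t *s b')"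
      unfolding l by (metis (lifting) subset_antisym image_subsetI rangeI)
    moreover have "a' $ 3 = 0" "b' $ 3 = 1"
      using False by (simp_all add: a'_def b'_def)
    ultimately show ?thesis
      using contractible_tetrablock_line_transversal by metis
  qed
qed

section \<open>The tetrablock\<close>

lemma domain_set_tetrablock: "domain_set tetrablock"
  unfolding domain_set_def
proof (intro conjI)
  show "open tetrablock"
    unfolding tetrablock_def by (intro open_Collect_less continuous_intros)
  have zero: "0 \<in> tetrablock"
    by (simp add: tetrablock_def)
  then show "tetrablock \<noteq> {}"
    by blast
  show "connected tetrablock"
  proof (rule connected_iff_connected_component [THEN iffD2], intro ballI)
    have "connected_component tetrablock 0 x" if x: "x \<in> tetrablock" for x
    proof (cases "x = 0")
      case True
      then show ?thesis
        using zero by simp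
    next
      case False
      let ?l = "range (\<lambda>t. 0 + t *s x)"
      have "complex_line ?l"
        using False unfolding complex_line_def by blast
      then have "connected (?l \<inter> tetrablock)"
        by (intro contractible_imp_connected contractible_tetrablock_line)
      moreover have "0 \<in> ?l" "x \<in> ?l"
        by (auto intro: image_eqI [where x = 0] image_eqI [where x = 1])
      ultimately show ?thesis
        using zero x unfolding connected_component_def by blast
    qed
    then show "connected_component tetrablock x y" if "x \<in> tetrablock" "y \<in> tetrablock" for x y
      using that by (meson connected_component_sym connected_component_trans)
  qed
qed

theorem corollary4p2: "C_convex tetrablock"
  unfolding C_convex_def
  using domain_set_tetrablock contractible_tetrablock_line contractible_imp_connected
    contractible_imp_simply_connected by blast

end
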